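(* Let $Q$ be a nondegenerate quadratic form on $\mathbb{R}^{3}$ with integral coefficients. Let $\xi\in\mathbb{Z}^{3}$ and $\eta\in\mathbb{N}$. Assume that there is a non-zero $x\in\mathbb{Z}^3$ such that $$Q(x)=0\quad\text{and}\quad x\equiv\xi \pmod{\eta}. \qquad ( * )$$ Then there exist two linearly independent vectors $a,b\in\mathbb{Z}^3$, each satisfying $( * )$, such that $$\|a\|\,\|b\|\ll H^{4}\,\eta^{6}\,|\det Q|^{4},$$ where the implied constant is absolute.
   Context: $\mathbb{N}$ denotes the positive integers and $\|\cdot\|$ the Euclidean norm on $\mathbb{R}^3$. A congruence of integer vectors modulo $\eta$ is coordinatewise. $H$ is the maximum of the absolute values of the coefficients of $Q$, and $\det Q$ is the determinant of the symmetric matrix of $Q$ (the matrix $A$ with $Q(x)=x^{T}Ax$); nondegenerate means $\det Q\neq 0$. The notation $X\ll Y$ means $X\le CY$ for a constant $C>0$ (the implied constant). *)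

theory Defs
  imports "HOL-Analysis.Analysis" "HOL-Number_Theory.Cong"
begin

definition quadratic_form :: "(real^'n \<Rightarrow> real) \<Rightarrow> bool" where
  "quadratic_form Q \<longleftrightarrow> (\<exists>A. transpose A = A \<and> (\<forall>x. Q x = x \<bullet> (A *v x)))"

definition qf_matrix :: "(real^'n \<Rightarrow> real) \<Rightarrow> real^'n^'n" where
  "qf_matrix Q = (THE A. transpose A = A \<and> (\<forall>x. Q x = x \<bullet> (A *v x)))"

lemma symmetric_matrix_eqI:
  fixes A B :: "real^'n^'n"
  assumes A: "transpose A = A" and B: "transpose B = B"
    and eq: "\<And>x. x \<bullet> (A *v x) = x \<bullet> (B *v x)"
  shows "A = B"
proof -
  have polar: "2 * (x \<bullet> (M *v y)) =
      (x + y) \<bullet> (M *v (x + y)) - x \<bullet> (M *v x) - y \<bullet> (M *v y)"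
    if "transpose M = M" for M :: "real^'n^'n" and x y
  proof -
    have "y \<bullet> (M *v x) = x \<bullet> (M *v y)"
      using dot_lmul_matrix[of y M x] transpose_matrix_vector[of M y] that
      by (simp add: inner_commute)
    then show ?thesis
      by (simp add: matrix_vector_right_distrib inner_add_left inner_add_right)
  qed
  have "x \<bullet> (A *v y) = x \<bullet> (B *v y)" for x y
    using polar[OF A, of x y] polar[OF B, of x y] eq by simp
  then have "A *v y = B *v y" for y
    using vector_eq_ldot by blast
  then show ?thesis
    by (simp add: matrix_eq)
qed

lemma qf_matrix:
  assumes "quadratic_form Q"
  shows transpose_qf_matrix: "transpose (qf_matrix Q) = qf_matrix Q"
    and qf_eq_matrix: "Q x = x \<bullet> (qf_matrix Q *v x)"
proof -
  obtain A where A: "transpose A = A \<and> (\<forall>x. Q x = x \<bullet> (A *v x))"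
    using assms unfolding quadratic_form_def by blast
  have "transpose (qf_matrix Q) = qf_matrix Q \<and> (\<forall>x. Q x = x \<bullet> (qf_matrix Q *v x))"
    unfolding qf_matrix_def
  proof (rule theI)
    fix B assume B: "transpose B = B \<and> (\<forall>x. Q x = x \<bullet> (B *v x))"
    show "B = A"
    proof (rule symmetric_matrix_eqI)
      show "x \<bullet> (B *v x) = x \<bullet> (A *v x)" for x
        using conjunct2[OF A, rule_format, of x] conjunct2[OF B, rule_format, of x]
        by argo
    qed (use A B in blast)+
  qed (use A in blast)
  then show "transpose (qf_matrix Q) = qf_matrix Q" "Q x = x \<bullet> (qf_matrix Q *v x)"
    by blast+
qed

(* The coefficient of x_i x_j in Q, viewed as a polynomial: an off-diagonal monomial
   collects two entries of the symmetric matrix, so integral coefficients allow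
   half-integral off-diagonal matrix entries. See qf_expand_3. *)
definition qf_coeff :: "(real^'n \<Rightarrow> real) \<Rightarrow> 'n \<Rightarrow> 'n \<Rightarrow> real" where
  "qf_coeff Q i j = (if i = j then qf_matrix Q $ i $ i else 2 * qf_matrix Q $ i $ j)"

lemma qf_expand_3:
  fixes Q :: "real^3 \<Rightarrow> real"
  assumes "quadratic_form Q"
  shows "Q x = qf_coeff Q 1 1 * (x$1)^2 + qf_coeff Q 2 2 * (x$2)^2 + qf_coeff Q 3 3 * (x$3)^2
    + qf_coeff Q 1 2 * (x$1 * x$2) + qf_coeff Q 1 3 * (x$1 * x$3) + qf_coeff Q 2 3 * (x$2 * x$3)"
proof -
  have "qf_matrix Q $ j $ i = qf_matrix Q $ i $ j" for i j
    using arg_cong[OF transpose_qf_matrix[OF assms], of "\<lambda>A. A $ i $ j"]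
    by (simp add: transpose_def)
  note sym = this[of 1 2] this[of 1 3] this[of 2 3]
  show ?thesis
    unfolding qf_eq_matrix[OF assms, of x]
    by (simp add: qf_coeff_def inner_vec_def matrix_vector_mult_def sum_3 sym
        power2_eq_square algebra_simps)
qed

definition integral_coeffs :: "(real^'n \<Rightarrow> real) \<Rightarrow> bool" where
  "integral_coeffs Q \<longleftrightarrow> (\<forall>i j. qf_coeff Q i j \<in> \<int>)"

definition qf_height :: "(real^'n \<Rightarrow> real) \<Rightarrow> real" where
  "qf_height Q = Max {\<bar>qf_coeff Q i j\<bar> | i j. True}"

definition qf_det :: "(real^'n \<Rightarrow> real) \<Rightarrow> real" where
  "qf_det Q = det (qf_matrix Q)"

definition nondegenerate :: "(real^'n \<Rightarrow> real) \<Rightarrow> bool" where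
  "nondegenerate Q \<longleftrightarrow> qf_det Q \<noteq> 0"

definition real_vec :: "int^'n \<Rightarrow> real^'n" where
  "real_vec x = (\<chi> i. real_of_int (x $ i))"

definition congruent_zero :: "(real^'n \<Rightarrow> real) \<Rightarrow> int^'n \<Rightarrow> nat \<Rightarrow> int^'n \<Rightarrow> bool" where
  "congruent_zero Q \<xi> \<eta> x \<longleftrightarrow> Q (real_vec x) = 0 \<and> (\<forall>i. [x $ i = \<xi> $ i] (mod int \<eta>))"

end

theory Submission
  imports Defs "HOL-Analysis.Kronecker_Approximation_Theorem"
begin

text \<open>
  A ternary form with a nontrivial rational zero \<open>e\<close> has all its rational zeros on a conic, and
  the lines through \<open>e\<close> parametrise this conic. Writing \<open>P\<close> for the polar form of \<open>Q\<close>
  (so \<open>P x x = 2 Q x\<close>), the line spanned projectively by \<open>e\<close> and \<open>u\<close> meets the conic again in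
  \<open>chord e u = Q(u) e - P(e,u) u\<close>, which is quadratic in \<open>u\<close> and integral for integral \<open>e\<close> and \<open>u\<close>.
  Zeros in a residue class are found by reducing the parameter \<open>u\<close>, rather than the zero itself.

  The proof rests on the identity \<open>polar_chord\<close>,
  \<open>P (chord e u) (chord e v) = D * det(e,u,v)\<^sup>2\<close>, where \<open>D = 4 det Q\<close>. It has three uses.
  \<^item> It makes \<open>chord e u\<close> nonzero as soon as \<open>u\<close> is not parallel to \<open>e\<close>. This gives a zero
    \<open>e\<close> with entries \<open>\<lless> H\<close> (\<open>small_primitive_zero\<close>): starting from an arbitrarily large
    primitive zero \<open>y\<close>, choose by Dirichlet's theorem an integral point \<open>b\<close> very close to the
    line of \<open>y\<close>; then \<open>chord y b\<close> depends only on the small deviation of \<open>b\<close> from this line.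
  \<^item> It bounds the common factor that a value of the parametrisation can have. Each primitive
    zero \<open>y\<close> satisfies \<open>g y = chord e s\<close> for some integral \<open>s\<close>, and if \<open>s\<close> is chosen so that
    \<open>det(e,s,t) = 1\<close> for some \<open>t\<close>, the identity shows that \<open>g\<close> divides \<open>D\<close>
    (\<open>zero_from_chord\<close>).
  \<^item> It shows that \<open>chord e u\<close> and \<open>chord e v\<close> are independent when \<open>e\<close>, \<open>u\<close>, \<open>v\<close> are,
    because two parallel zeros are orthogonal for \<open>P\<close> (\<open>independent_zeros\<close>).

  Now write the given solution as \<open>x = k y\<close> with \<open>y\<close> primitive. If
  \<open>u\<close> is congruent to \<open>s\<close> modulo \<open>g \<eta>\<close> then \<open>chord e u = g r\<close> with \<open>r\<close> congruent to \<open>y\<close> modulo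
  \<open>\<eta>\<close>, so \<open>k' r\<close> solves the problem, where \<open>k'\<close> is the residue of \<open>k\<close> in \<open>{1..\<eta>}\<close>. With
  \<open>u\<close> of size \<open>\<bar>g\<bar> \<eta>\<close> the vector \<open>k' r\<close> has size
  \<open>\<lless> \<eta> * H * H * (g \<eta>)\<^sup>2 / \<bar>g\<bar>\<close>, that is \<open>\<lless> H\<^sup>2 * \<bar>D\<bar> * \<eta>\<^sup>3\<close>, and two such \<open>u\<close> that are
  independent together with \<open>e\<close> are always available (\<open>independent_shift\<close>). The product of the two norms is
  therefore \<open>\<lless> H^4 * \<eta>^6 * D\<^sup>2\<close>, and \<open>D\<^sup>2 \<le> D^4\<close> because \<open>D\<close> is a nonzero integer.
\<close>

section \<open>Integral vectors in dimension three\<close>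

definition idot :: "int^3 \<Rightarrow> int^3 \<Rightarrow> int" (infixl "\<bullet>\<^sub>Z" 70) where
  "x \<bullet>\<^sub>Z y = x$1 * y$1 + x$2 * y$2 + x$3 * y$3"

definition icross :: "int^3 \<Rightarrow> int^3 \<Rightarrow> int^3" (infixl "\<times>\<^sub>Z" 75) where
  "x \<times>\<^sub>Z y = vector [x$2 * y$3 - x$3 * y$2, x$3 * y$1 - x$1 * y$3, x$1 * y$2 - x$2 * y$1]"

text \<open>By Bezout, this says that the coordinates have no common divisor; the vector \<open>t\<close> is what the
  proofs use.\<close>
definition primitive :: "int^3 \<Rightarrow> bool" where
  "primitive x \<longleftrightarrow> (\<exists>t. t \<bullet>\<^sub>Z x = 1)"

lemma icross_nth [simp]:
  "(x \<times>\<^sub>Z y)$1 = x$2 * y$3 - x$3 * y$2"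
  "(x \<times>\<^sub>Z y)$2 = x$3 * y$1 - x$1 * y$3"
  "(x \<times>\<^sub>Z y)$3 = x$1 * y$2 - x$2 * y$1"
  by (simp_all add: icross_def)

lemma icross_triple: "x \<times>\<^sub>Z (y \<times>\<^sub>Z z) = (x \<bullet>\<^sub>Z z) *s y - (x \<bullet>\<^sub>Z y) *s z"
  by (simp add: vec_eq_iff forall_3 idot_def algebra_simps)

lemma primitive_part:
  assumes "v \<noteq> 0"
  obtains h n where "h \<noteq> 0" "primitive n" "v = h *s n"
proof -
  define h where "h = gcd (gcd (v$1) (v$2)) (v$3)"
  have "h \<noteq> 0"
    using assms by (auto simp: h_def vec_eq_iff forall_3)
  have "h dvd v$i" for i
    using exhaust_3[of i] by (auto simp: h_def intro: dvd_trans)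
  then have v: "v = h *s (\<chi> i. v$i div h)"
    by (simp add: vec_eq_iff)
  obtain p q where pq: "p * v$1 + q * v$2 = gcd (v$1) (v$2)"
    using bezout_int by blast
  obtain r t where rt: "r * gcd (v$1) (v$2) + t * v$3 = h"
    using bezout_int h_def by blast
  have "vector [r * p, r * q, t] \<bullet>\<^sub>Z v = h"
    unfolding rt[symmetric] pq[symmetric] by (simp add: idot_def algebra_simps)
  moreover have "x \<bullet>\<^sub>Z (h *s y) = h * (x \<bullet>\<^sub>Z y)" for x y
    by (simp add: idot_def algebra_simps)
  ultimately have "h * (vector [r * p, r * q, t] \<bullet>\<^sub>Z (\<chi> i. v$i div h)) = h"
    using v by metis
  then have "primitive (\<chi> i. v$i div h)"
    using \<open>h \<noteq> 0\<close> unfolding primitive_def by (metis mult_cancel_left2)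
  with v \<open>h \<noteq> 0\<close> that show thesis by blast
qed

lemma idot_self_eq_0: "x \<bullet>\<^sub>Z x = 0 \<longleftrightarrow> x = 0"
proof
  assume "x \<bullet>\<^sub>Z x = 0"
  then have "(x$1)^2 + (x$2)^2 + (x$3)^2 = 0"
    by (simp add: idot_def power2_eq_square)
  then show "x = 0"
    by (auto simp: vec_eq_iff forall_3 add_nonneg_eq_0_iff)
qed (simp add: idot_def)

text \<open>The candidates are \<open>s\<close> and its three translates by \<open>m\<close> times a unit vector. If every two of
  them were dependent modulo \<open>e\<close>, the determinants with \<open>s\<close> itself would give that \<open>e \<times> s\<close>
  vanishes, and then those of two translates are, up to sign, \<open>m\<^sup>2\<close> times the coordinates of \<open>e\<close>,
  which are not all zero.\<close>
lemma independent_shift: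
  assumes "e \<noteq> 0" "m \<noteq> 0"
  obtains z w where "\<And>i. 0 \<le> z$i \<and> z$i \<le> 1" "\<And>i. 0 \<le> w$i \<and> w$i \<le> 1"
    "(s + m *s w) \<bullet>\<^sub>Z (e \<times>\<^sub>Z (s + m *s z)) \<noteq> 0"
proof (rule ccontr)
  assume "\<not> thesis"
  with that have *: "(s + m *s w) \<bullet>\<^sub>Z (e \<times>\<^sub>Z (s + m *s z)) = 0"
    if "\<And>i. 0 \<le> z$i \<and> z$i \<le> 1" "\<And>i. 0 \<le> w$i \<and> w$i \<le> 1" for z w
    using that by blast
  have ax: "0 \<le> axis j (1::int) $ i \<and> axis j (1::int) $ i \<le> 1" for i j :: 3
    by (simp add: axis_def)
  have zero: "0 \<le> (0::int^3) $ i \<and> (0::int^3) $ i \<le> 1" for i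
    by simp
  have "m * (axis j 1 \<bullet>\<^sub>Z (e \<times>\<^sub>Z s)) = 0" for j
    using *[OF zero ax[of j]] by (simp add: idot_def algebra_simps)
  then have n: "axis j 1 \<bullet>\<^sub>Z (e \<times>\<^sub>Z s) = 0" for j
    using assms(2) by simp
  have "m^2 * (axis j 1 \<bullet>\<^sub>Z (e \<times>\<^sub>Z axis k 1)) = 0" for j k
  proof -
    have "(s + m *s axis j 1) \<bullet>\<^sub>Z (e \<times>\<^sub>Z (s + m *s axis k 1))
      = m * (axis j 1 \<bullet>\<^sub>Z (e \<times>\<^sub>Z s)) - m * (axis k 1 \<bullet>\<^sub>Z (e \<times>\<^sub>Z s))
        + m^2 * (axis j 1 \<bullet>\<^sub>Z (e \<times>\<^sub>Z axis k 1))"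
      by (simp add: idot_def power2_eq_square algebra_simps)
    then show ?thesis
      using *[OF ax[of k] ax[of j]] n[of j] n[of k] by simp
  qed
  then have a: "axis j 1 \<bullet>\<^sub>Z (e \<times>\<^sub>Z axis k 1) = 0" for j k
    using assms(2) by simp
  from a[of 1 2] a[of 2 3] a[of 3 1] assms(1) show False
    by (simp add: idot_def axis_def vec_eq_iff forall_3)
qed

lemma parallel_to_primitive:
  assumes "primitive e" "e \<times>\<^sub>Z v = 0"
  obtains c where "v = c *s e"
proof -
  obtain t where t: "t \<bullet>\<^sub>Z e = 1"
    using assms(1) primitive_def by blast
  have "(t \<bullet>\<^sub>Z v) *s e - (t \<bullet>\<^sub>Z e) *s v = t \<times>\<^sub>Z (e \<times>\<^sub>Z v)"
    by (simp add: icross_triple)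
  also have "\<dots> = 0"
    by (simp add: assms(2) vec_eq_iff forall_3)
  finally have "v = (t \<bullet>\<^sub>Z v) *s e"
    by (simp add: t)
  then show thesis using that by blast
qed

text \<open>Modulo the primitive vector \<open>e\<close>, every \<open>v\<close> is a multiple of a vector \<open>s\<close> that is primitive
  in the quotient lattice. Primitivity in the quotient is expressed by the normal \<open>e \<times> s\<close> of the plane
  through \<open>e\<close> and \<open>v\<close>: every \<open>n\<close> orthogonal to \<open>e\<close> has the form \<open>e \<times> s\<close>, namely with
  \<open>s = n \<times> t\<close> where \<open>t \<cdot> e = 1\<close>.\<close>
lemma primitive_normal_of_line:
  assumes "primitive e" "e \<times>\<^sub>Z v \<noteq> 0"
  obtains h c s where "h \<noteq> 0" "v = h *s s + c *s e" "primitive (e \<times>\<^sub>Z s)"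
proof -
  obtain h n where n: "h \<noteq> 0" "primitive n" "e \<times>\<^sub>Z v = h *s n"
    using primitive_part[OF assms(2)] .
  obtain t where t: "t \<bullet>\<^sub>Z e = 1"
    using assms(1) primitive_def by blast
  have "h * (e \<bullet>\<^sub>Z n) = e \<bullet>\<^sub>Z (e \<times>\<^sub>Z v)"
    unfolding n(3) by (simp add: idot_def algebra_simps)
  also have "\<dots> = 0"
    by (simp add: idot_def algebra_simps)
  finally have en: "e \<bullet>\<^sub>Z n = 0"
    using \<open>h \<noteq> 0\<close> by simp
  define s where "s = n \<times>\<^sub>Z t"
  have s: "e \<times>\<^sub>Z s = n"
    using en t by (simp add: s_def icross_triple) (simp add: idot_def mult.commute)
  have "e \<times>\<^sub>Z (v - h *s s) = e \<times>\<^sub>Z v - h *s (e \<times>\<^sub>Z s)"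
    by (simp add: vec_eq_iff forall_3 algebra_simps)
  then have "e \<times>\<^sub>Z (v - h *s s) = 0"
    by (simp add: s n(3))
  then obtain c where "v - h *s s = c *s e"
    using parallel_to_primitive[OF assms(1)] by blast
  then have "v = h *s s + c *s e"
    by (metis add.commute diff_add_cancel)
  with n(1,2) s that show thesis by blast
qed

section \<open>Integral ternary forms and the chord parametrisation\<close>

locale ternary_form =
  fixes c11 c22 c33 c12 c13 c23 :: int
begin

definition qf :: "int^3 \<Rightarrow> int" where
  "qf x = c11 * (x$1)^2 + c22 * (x$2)^2 + c33 * (x$3)^2
     + c12 * (x$1 * x$2) + c13 * (x$1 * x$3) + c23 * (x$2 * x$3)"

definition gradient :: "int^3 \<Rightarrow> int^3" where
  "gradient x = vector [2 * c11 * x$1 + c12 * x$2 + c13 * x$3,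
     c12 * x$1 + 2 * c22 * x$2 + c23 * x$3, c13 * x$1 + c23 * x$2 + 2 * c33 * x$3]"

definition polar :: "int^3 \<Rightarrow> int^3 \<Rightarrow> int" where
  "polar x y = gradient x \<bullet>\<^sub>Z y"

text \<open>Half the determinant of the polar form, equivalently four times the determinant of the symmetric
  matrix of the form.\<close>
definition disc :: int where
  "disc = 4 * c11 * c22 * c33 + c12 * c13 * c23 - c11 * c23^2 - c22 * c13^2 - c33 * c12^2"

text \<open>If \<open>e\<close> is a zero, this is the second zero on the projective line through \<open>e\<close> and \<open>u\<close>
  (again \<open>e\<close> if the line is tangent): \<open>qf (\<alpha> *s e + \<beta> *s u) = \<beta> * (\<alpha> * polar e u + \<beta> * qf u)\<close>.\<close>
definition chord :: "int^3 \<Rightarrow> int^3 \<Rightarrow> int^3" where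
  "chord e u = qf u *s e - polar e u *s u"

lemmas coords = qf_def polar_def gradient_def idot_def

lemma qf_add: "qf (x + y) = qf x + qf y + polar x y"
  by (simp add: coords power2_eq_square algebra_simps)

lemma qf_scale: "qf (k *s x) = k^2 * qf x"
  by (simp add: coords power2_eq_square algebra_simps)

lemma polar_commute: "polar x y = polar y x"
  by (simp add: coords algebra_simps)

lemma polar_self: "polar x x = 2 * qf x"
  by (simp add: coords power2_eq_square algebra_simps)

lemma polar_add_right: "polar x (y + z) = polar x y + polar x z"
  by (simp add: coords algebra_simps)

lemma polar_diff_right: "polar x (y - z) = polar x y - polar x z"
  by (simp add: coords algebra_simps)

lemma polar_scale_right: "polar x (k *s y) = k * polar x y"
  by (simp add: coords algebra_simps)

lemma polar_add_left: "polar (x + y) z = polar x z + polar y z"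
  by (simp add: coords algebra_simps)

lemma polar_diff_left: "polar (x - y) z = polar x z - polar y z"
  by (simp add: coords algebra_simps)

lemma polar_scale_left: "polar (k *s x) y = k * polar x y"
  by (simp add: coords algebra_simps)

lemmas polar_simps = polar_add_right polar_diff_right polar_scale_right
  polar_add_left polar_diff_left polar_scale_left polar_self

text \<open>The left-hand side is half the Gram determinant of \<open>e\<close>, \<open>u\<close>, \<open>v\<close> for the polar form, whose
  matrix \<open>M\<close> has determinant \<open>2 * disc\<close>.\<close>
lemma gram_isotropic:
  assumes "qf e = 0"
  shows "polar e u * polar e v * polar u v - (polar e u)^2 * qf v - (polar e v)^2 * qf u
    = disc * (v \<bullet>\<^sub>Z (e \<times>\<^sub>Z u))^2"
proof -
  define M :: "int^3^3" where "M = vector [gradient (axis 1 1), gradient (axis 2 1), gradient (axis 3 1)]"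
  define V :: "int^3^3" where "V = vector [e, u, v]"
  have M: "M *v x = gradient x" for x
    by (simp add: M_def gradient_def vec_eq_iff forall_3 matrix_vector_mult_def sum_3 axis_def)
  have "(V ** M ** transpose V) $ i $ j = polar (V$i) (V$j)" for i j
    unfolding matrix_matrix_mult_def
    using exhaust_3[of i] exhaust_3[of j]
    by (auto simp: M_def polar_def gradient_def idot_def sum_3 axis_def transpose_def algebra_simps)
  then have "det (V ** M ** transpose V) = 2 *
     (polar e u * polar e v * polar u v - (polar e u)^2 * qf v - (polar e v)^2 * qf u)"
    using assms
    by (simp add: det_3 V_def polar_self polar_commute[of u e] polar_commute[of v e]
        polar_commute[of v u] power2_eq_square algebra_simps)
  moreover have "det (V ** M ** transpose V) = det M * (det V)^2"
    by (simp add: det_mul power2_eq_square)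
  moreover have "det M = 2 * disc"
    by (simp add: det_3 M_def gradient_def axis_def disc_def power2_eq_square algebra_simps)
  moreover have "det V = v \<bullet>\<^sub>Z (e \<times>\<^sub>Z u)"
    by (simp add: det_3 V_def idot_def algebra_simps)
  ultimately show ?thesis by simp
qed

text \<open>The parametrisation depends only on the line, up to a square factor. This allows moving a
  parameter along \<open>e\<close>, and dividing out common factors modulo \<open>e\<close>.\<close>
lemma chord_line:
  assumes "qf e = 0"
  shows "chord e (k *s u + t *s e) = k^2 *s chord e u"
proof -
  have "qf (k *s u + t *s e) = k^2 * qf u + k * t * polar e u"
    using assms by (simp add: qf_add qf_scale polar_simps polar_commute[of u e])
  moreover have "polar e (k *s u + t *s e) = k * polar e u"
    using assms by (simp add: polar_simps)
  ultimately show ?thesis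
    by (simp add: chord_def vec_eq_iff algebra_simps power2_eq_square)
qed

text \<open>Expanding the left-hand side with \<open>qf e = 0\<close> leaves exactly the Gram expression of
  \<open>gram_isotropic\<close>.\<close>
lemma polar_chord:
  assumes "qf e = 0"
  shows "polar (chord e u) (chord e v) = disc * (v \<bullet>\<^sub>Z (e \<times>\<^sub>Z u))^2"
  unfolding gram_isotropic[OF assms, symmetric] chord_def
  using assms
  by (simp add: polar_simps polar_commute[of u e] power2_eq_square algebra_simps)

lemma qf_chord:
  assumes "qf e = 0"
  shows "qf (chord e u) = 0"
proof -
  have "u \<bullet>\<^sub>Z (e \<times>\<^sub>Z u) = 0"
    by (simp add: idot_def algebra_simps)
  then show ?thesis
    using polar_chord[OF assms, of u u] by (simp add: polar_self)
qed

lemma chord_bound: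
  assumes H: "\<bar>c11\<bar> \<le> H" "\<bar>c22\<bar> \<le> H" "\<bar>c33\<bar> \<le> H" "\<bar>c12\<bar> \<le> H" "\<bar>c13\<bar> \<le> H" "\<bar>c23\<bar> \<le> H"
    and e: "\<And>i. \<bar>e$i\<bar> \<le> E" and u: "\<And>i. \<bar>u$i\<bar> \<le> U"
  shows "\<bar>chord e u $ i\<bar> \<le> 18 * H * E * U^2"
proof -
  have nn: "0 \<le> H" "0 \<le> E" "0 \<le> U"
    using H(1) e[of 1] u[of 1] by linarith+
  have mon: "c * (x * y) \<le> H * (X * Y) \<and> - (c * (x * y)) \<le> H * (X * Y)"
    if "\<bar>c\<bar> \<le> H" "\<bar>x\<bar> \<le> X" "\<bar>y\<bar> \<le> Y" for c x y X Y
    using that unfolding abs_le_iff[symmetric] by (auto simp: abs_mult intro!: mult_mono)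
  have q: "\<bar>qf u\<bar> \<le> 6 * (H * (U * U))"
    using mon[OF H(1) u u, of 1 1] mon[OF H(2) u u, of 2 2] mon[OF H(3) u u, of 3 3]
      mon[OF H(4) u u, of 1 2] mon[OF H(5) u u, of 1 3] mon[OF H(6) u u, of 2 3]
    unfolding qf_def power2_eq_square abs_le_iff by linarith
  have "polar e u = 2 * (c11 * (e$1 * u$1)) + 2 * (c22 * (e$2 * u$2)) + 2 * (c33 * (e$3 * u$3))
    + c12 * (e$1 * u$2) + c12 * (e$2 * u$1) + c13 * (e$1 * u$3) + c13 * (e$3 * u$1)
    + c23 * (e$2 * u$3) + c23 * (e$3 * u$2)"
    by (simp add: coords algebra_simps)
  then have p: "\<bar>polar e u\<bar> \<le> 12 * (H * (E * U))"
    using mon[OF H(1) e u, of 1 1] mon[OF H(2) e u, of 2 2] mon[OF H(3) e u, of 3 3]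
      mon[OF H(4) e u, of 1 2] mon[OF H(4) e u, of 2 1] mon[OF H(5) e u, of 1 3]
      mon[OF H(5) e u, of 3 1] mon[OF H(6) e u, of 2 3] mon[OF H(6) e u, of 3 2]
    unfolding abs_le_iff by linarith
  have "\<bar>chord e u $ i\<bar> \<le> \<bar>qf u * e$i\<bar> + \<bar>polar e u * u$i\<bar>"
    by (simp add: chord_def)
  also have "\<dots> \<le> 6 * (H * (U * U)) * E + 12 * (H * (E * U)) * U"
    unfolding abs_mult using q p e u nn by (intro add_mono mult_mono) auto
  also have "\<dots> = 18 * H * E * U^2"
    by (simp add: power2_eq_square)
  finally show ?thesis .
qed

lemma chord_nonzero:
  assumes "disc \<noteq> 0" "qf e = 0" "e \<times>\<^sub>Z u \<noteq> 0"
  shows "chord e u \<noteq> 0"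
proof
  assume "chord e u = 0"
  then have "polar (chord e u) (chord e (e \<times>\<^sub>Z u)) = 0"
    by (simp add: coords)
  then have "(e \<times>\<^sub>Z u) \<bullet>\<^sub>Z (e \<times>\<^sub>Z u) = 0"
    using polar_chord[OF assms(2), of u "e \<times>\<^sub>Z u"] assms(1) by simp
  with assms(3) show False by (simp only: idot_self_eq_0)
qed

lemma gradient_nonzero:
  assumes "disc \<noteq> 0" "qf e = 0" "e \<noteq> 0"
  shows "gradient e \<noteq> 0"
proof
  assume "gradient e = 0"
  then have p: "polar e u = 0" for u
    by (simp add: polar_def idot_def)
  have n: "e \<times>\<^sub>Z u = 0" for u
    using gram_isotropic[OF assms(2), of u "e \<times>\<^sub>Z u"] assms(1)
    by (simp add: p idot_self_eq_0)
  from n[of "axis 1 1"] n[of "axis 2 1"] assms(3) show False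
    by (simp add: vec_eq_iff forall_3 axis_def)
qed

lemma height_pos:
  assumes "disc \<noteq> 0"
    and H: "\<bar>c11\<bar> \<le> H" "\<bar>c22\<bar> \<le> H" "\<bar>c33\<bar> \<le> H" "\<bar>c12\<bar> \<le> H" "\<bar>c13\<bar> \<le> H" "\<bar>c23\<bar> \<le> H"
  shows "1 \<le> H"
proof (rule ccontr)
  assume "\<not> 1 \<le> H"
  with H have c: "c11 = 0" "c22 = 0" "c33 = 0" "c12 = 0" "c13 = 0" "c23 = 0" by linarith+
  have "disc = 0" unfolding disc_def by (simp add: c)
  with assms(1) show False by blast
qed

section \<open>A small zero\<close>

text \<open>Let \<open>E\<close> be the largest entry of \<open>y\<close> in absolute value. Simultaneous approximation of the
  ratios of the entries, with \<open>N\<^sup>2\<close> just below \<open>E\<close>, gives an integral \<open>b\<close> whose distance to the line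
  of \<open>y\<close> is at most \<open>1 / N\<close>, hence roughly \<open>1 / sqrt E\<close>. Since \<open>chord y b\<close> depends on \<open>b\<close> only modulo this line, its entries are
  \<open>\<lless> H * E * (1 / N)\<^sup>2\<close>, which is \<open>\<lless> H\<close>. The denominator of the approximation is at most
  \<open>N\<^sup>2\<close>, thus smaller than \<open>E\<close>, so \<open>b\<close> cannot lie on the line of the primitive vector \<open>y\<close>, and
  \<open>chord y b\<close> is not zero.\<close>
lemma small_primitive_zero:
  assumes "disc \<noteq> 0"
    and H: "\<bar>c11\<bar> \<le> H" "\<bar>c22\<bar> \<le> H" "\<bar>c33\<bar> \<le> H" "\<bar>c12\<bar> \<le> H" "\<bar>c13\<bar> \<le> H" "\<bar>c23\<bar> \<le> H"
    and y: "primitive y" "qf y = 0"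
  obtains e where "primitive e" "qf e = 0" "\<And>i. \<bar>e$i\<bar> \<le> 72 * H"
proof -
  have H1: "1 \<le> H"
    using height_pos[OF assms(1) H] .
  have "Max (range (\<lambda>i. \<bar>y$i\<bar>)) \<in> range (\<lambda>i. \<bar>y$i\<bar>)"
    by (rule Max_in) auto
  then obtain j where j: "Max (range (\<lambda>i. \<bar>y$i\<bar>)) = \<bar>y$j\<bar>"
    unfolding image_iff by blast
  define E where "E = \<bar>y$j\<bar>"
  have yE: "\<bar>y$i\<bar> \<le> E" for i
    unfolding E_def j[symmetric] by (rule Max_ge) auto
  show thesis
  proof (cases "E \<le> 1")
    case True
    have "\<bar>y$i\<bar> \<le> 72 * H" for i
      using yE[of i] True H1 by linarith
    with y that show thesis by blast
  next
    case False
    then have yj: "y$j \<noteq> 0" by (auto simp: E_def)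
    define N where "N = (LEAST n::nat. E \<le> (int n + 1)^2)"
    have "E \<le> (int (nat E) + 1)^2"
      using False by (simp add: power2_eq_square algebra_simps)
    then have N_up: "E \<le> (int N + 1)^2"
      unfolding N_def by (rule LeastI)
    have "N \<noteq> 0"
      using N_up False by (intro notI) simp
    then have "\<not> E \<le> (int (N - 1) + 1)^2"
      using not_less_Least[of "N - 1" "\<lambda>n. E \<le> (int n + 1)^2"] by (simp add: N_def)
    then have N_low: "int N^2 < E"
      using \<open>N \<noteq> 0\<close> by simp
    obtain k l :: 3 where kl: "j \<noteq> k" "j \<noteq> l" "k \<noteq> l" and UN: "\<And>i. i = j \<or> i = k \<or> i = l"
    proof -
      consider "j = 1" | "j = 2" | "j = 3" using exhaust_3[of j] by blast
      then show thesis
      proof cases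
        case 1 show thesis by (rule that[of 2 3]) (use 1 exhaust_3 in auto)
      next
        case 2 show thesis by (rule that[of 1 3]) (use 2 exhaust_3 in auto)
      next
        case 3 show thesis by (rule that[of 1 2]) (use 3 exhaust_3 in auto)
      qed
    qed
    define \<theta> :: "nat \<Rightarrow> real" where "\<theta> i = (if i = 0 then y$k else y$l) / y$j" for i
    obtain q p where q: "0 < q" "q \<le> int (N^2)"
      and p: "\<And>i. i < 2 \<Longrightarrow> \<bar>of_int q * \<theta> i - of_int (p i)\<bar> < 1 / N"
      using Dirichlet_approx_simult[of N 2 \<theta>] \<open>N \<noteq> 0\<close> by blast
    define b :: "int^3" where "b = (\<chi> i. if i = j then q else if i = k then p 0 else p 1)"
    \<comment> \<open>\<open>w\<close> is \<open>y$j\<close> times the deviation of \<open>b\<close> from the line of \<open>y\<close>; scaling by \<open>y$j\<close> keeps it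
      integral.\<close>
    define w where "w = (y$j) *s b + (- q) *s y"
    have approx: "int N * \<bar>y$j * r - q * t\<bar> \<le> E"
      if "\<bar>of_int q * (real_of_int t / y$j) - of_int r\<bar> < 1 / N" for r t
    proof -
      have "real N * \<bar>real_of_int (y$j)\<bar> * \<bar>of_int q * (real_of_int t / y$j) - of_int r\<bar>
          < real N * \<bar>real_of_int (y$j)\<bar> * (1 / N)"
        using that \<open>N \<noteq> 0\<close> yj by (intro mult_strict_left_mono) auto
      also have "\<dots> = real_of_int E"
        using \<open>N \<noteq> 0\<close> by (simp add: E_def)
      also have "real N * \<bar>real_of_int (y$j)\<bar> * \<bar>of_int q * (real_of_int t / y$j) - of_int r\<bar>
          = real N * \<bar>real_of_int (y$j) * (of_int q * (real_of_int t / y$j) - of_int r)\<bar>"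
        by (simp add: abs_mult)
      also have "real_of_int (y$j) * (of_int q * (real_of_int t / y$j) - of_int r)
          = of_int (q * t - y$j * r)"
        using yj by (simp add: field_simps)
      also have "real N * \<bar>real_of_int (q * t - y$j * r)\<bar> = real_of_int (int N * \<bar>y$j * r - q * t\<bar>)"
        by (simp add: abs_minus_commute)
      finally show ?thesis by linarith
    qed
    have "int N * \<bar>w$i\<bar> \<le> E" for i
    proof -
      consider "i = j" | "i = k" | "i = l" using UN by blast
      then show ?thesis
      proof cases
        case 1 then show ?thesis by (simp add: w_def b_def E_def)
      next
        case 2
        then show ?thesis
          using approx[of "y$k" "p 0"] p[of 0] kl by (simp add: \<theta>_def w_def b_def)
      next
        case 3
        then show ?thesis
          using approx[of "y$l" "p 1"] p[of 1] kl by (simp add: \<theta>_def w_def b_def)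
      qed
    qed
    then have wU: "\<bar>w$i\<bar> \<le> E div int N" for i
      using zdiv_mono1[of "int N * \<bar>w$i\<bar>" E "int N"] \<open>N \<noteq> 0\<close> by simp
    have N_div: "int N * (E div int N) \<le> E"
      using mult_div_mod_eq[of "int N" E] pos_mod_sign[of "int N" E] \<open>N \<noteq> 0\<close> by linarith
    have chord_w: "chord y w = (y$j)^2 *s chord y b"
      unfolding w_def by (rule chord_line) fact
    have small: "\<bar>chord y b $ i\<bar> \<le> 72 * H" for i
    proof -
      have "E^2 * \<bar>chord y b $ i\<bar> = \<bar>chord y w $ i\<bar>"
        by (simp add: chord_w abs_mult E_def)
      also have "\<dots> \<le> 18 * H * E * (E div int N)^2"
        by (rule chord_bound[OF H yE wU])
      finally have "int N^2 * (E^2 * \<bar>chord y b $ i\<bar>) \<le> int N^2 * (18 * H * E * (E div int N)^2)"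
        by (intro mult_left_mono) auto
      also have "\<dots> = 18 * H * E * (int N * (E div int N))^2"
        by (simp add: power_mult_distrib)
      also have "\<dots> \<le> 18 * H * E * E^2"
        using False H1 \<open>N \<noteq> 0\<close>
        by (intro mult_left_mono power_mono N_div) (auto simp: pos_imp_zdiv_nonneg_iff)
      finally have "E^2 * (int N^2 * \<bar>chord y b $ i\<bar>) \<le> E^2 * (18 * H * E)"
        by (simp add: ac_simps)
      then have "int N^2 * \<bar>chord y b $ i\<bar> \<le> 18 * H * E"
        using False by (simp add: mult_le_cancel_left)
      also have "\<dots> \<le> 18 * H * (2 * int N)^2"
        using H1 \<open>N \<noteq> 0\<close> by (intro mult_left_mono order.trans[OF N_up] power_mono) auto
      finally have "int N^2 * \<bar>chord y b $ i\<bar> \<le> int N^2 * (72 * H)"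
        by (simp add: power_mult_distrib ac_simps)
      then show ?thesis
        using \<open>N \<noteq> 0\<close> by (simp add: mult_le_cancel_left)
    qed
    have "y \<times>\<^sub>Z b \<noteq> 0"
    proof
      assume "y \<times>\<^sub>Z b = 0"
      then obtain c where "b = c *s y"
        using parallel_to_primitive[OF y(1)] by blast
      then have "b$j = c * y$j" by simp
      then have "y$j dvd q" by (simp add: b_def)
      then have "E \<le> q"
        using q(1) by (simp add: E_def zdvd_imp_le)
      with q(2) N_low show False by simp
    qed
    then obtain h e where e: "h \<noteq> 0" "primitive e" "chord y b = h *s e"
      using primitive_part chord_nonzero[OF assms(1) y(2)] by metis
    have "h^2 * qf e = 0"
      using qf_chord[OF y(2), of b] unfolding e(3) qf_scale .
    then have "qf e = 0" using e(1) by simp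
    moreover have "\<bar>e$i\<bar> \<le> 72 * H" for i
    proof -
      have "1 * \<bar>e$i\<bar> \<le> \<bar>h\<bar> * \<bar>e$i\<bar>"
        using e(1) by (intro mult_right_mono) auto
      also have "\<dots> = \<bar>chord y b $ i\<bar>"
        by (simp add: e(3) abs_mult)
      finally show ?thesis using small[of i] by simp
    qed
    ultimately show thesis using e(2) that by blast
  qed
qed

section \<open>Every zero as a value of the parametrisation\<close>

text \<open>A zero \<open>y\<close> lies on the line through \<open>e\<close> and \<open>y\<close>, or on the tangent at \<open>e\<close> if \<open>y\<close> is parallel to
  \<open>e\<close>. The parameter \<open>s\<close> is taken primitive modulo \<open>e\<close> on that line. Then \<open>polar_chord\<close> exhibits
  \<open>disc\<close> as a value of the polar form with \<open>g *s y\<close> as one argument.\<close>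
lemma zero_from_chord:
  assumes "disc \<noteq> 0" and e: "primitive e" "qf e = 0" and y: "primitive y" "qf y = 0"
  obtains s g where "chord e s = g *s y" "g dvd disc"
proof -
  have "\<exists>v. e \<times>\<^sub>Z v \<noteq> 0 \<and> y \<times>\<^sub>Z chord e v = 0"
  proof (cases "e \<times>\<^sub>Z y = 0")
    case False
    have "y \<times>\<^sub>Z chord e y = 0"
      using y(2) by (simp add: chord_def vec_eq_iff forall_3)
    with False show ?thesis by blast
  next
    case True
    then obtain c where c: "y = c *s e"
      using parallel_to_primitive[OF e(1)] by blast
    \<comment> \<open>A direction of the tangent: \<open>v\<close> is orthogonal to the gradient at \<open>e\<close>.\<close>
    define v where "v = gradient e \<times>\<^sub>Z e"
    have "e \<noteq> 0"
      using e(1) by (auto simp: primitive_def idot_def)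
    have "e \<bullet>\<^sub>Z gradient e = 0"
      using polar_self[of e] e(2) by (simp add: polar_def idot_def mult.commute)
    then have "e \<times>\<^sub>Z v = (e \<bullet>\<^sub>Z e) *s gradient e"
      by (simp add: v_def icross_triple)
    moreover have "\<dots> \<noteq> 0"
      using gradient_nonzero[OF assms(1) e(2) \<open>e \<noteq> 0\<close>] \<open>e \<noteq> 0\<close> idot_self_eq_0[of e]
      by (auto simp: vec_eq_iff)
    moreover have "polar e v = 0"
      by (simp add: polar_def v_def idot_def algebra_simps)
    then have "y \<times>\<^sub>Z chord e v = 0"
      by (simp add: chord_def c vec_eq_iff forall_3)
    ultimately show ?thesis by metis
  qed
  then obtain v where v: "e \<times>\<^sub>Z v \<noteq> 0" "y \<times>\<^sub>Z chord e v = 0" by blast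
  obtain h c s where s: "h \<noteq> 0" "v = h *s s + c *s e" "primitive (e \<times>\<^sub>Z s)"
    using primitive_normal_of_line[OF e(1) v(1)] .
  have "h^2 *s (y \<times>\<^sub>Z chord e s) = y \<times>\<^sub>Z chord e v"
    unfolding s(2) chord_line[OF e(2)] by (simp add: vec_eq_iff forall_3 algebra_simps)
  then have "y \<times>\<^sub>Z chord e s = 0"
    using v(2) s(1) by (simp add: vec_eq_iff)
  then obtain g where g: "chord e s = g *s y"
    using parallel_to_primitive[OF y(1)] by blast
  obtain t where "t \<bullet>\<^sub>Z (e \<times>\<^sub>Z s) = 1"
    using s(3) primitive_def by blast
  then have "disc = polar (chord e s) (chord e t)"
    by (simp add: polar_chord[OF e(2)])
  also have "\<dots> = g * polar y (chord e t)"
    by (simp add: g polar_scale_left)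
  finally have "g dvd disc" by simp
  with g that show thesis by blast
qed

section \<open>Two independent zeros in a residue class\<close>

lemma chord_shift:
  obtains z' where "chord e (s + m *s z) = chord e s + m *s z'"
proof
  show "chord e (s + m *s z) = chord e s + m *s ((polar s z + m * qf z) *s e
      - polar e z *s (s + m *s z) - polar e s *s z)"
    by (simp add: chord_def qf_add qf_scale polar_simps vec_eq_iff algebra_simps power2_eq_square)
qed

text \<open>Reducing the parameter \<open>s0\<close> of the primitive zero modulo \<open>\<bar>g\<bar> * \<eta>\<close> keeps both the divisibility
  of the chord by \<open>g\<close> and the residue class of the quotient modulo \<open>\<eta>\<close>. The constant is
  \<open>18 * 72 * 2\<^sup>2\<close>, from \<open>chord_bound\<close>, \<open>small_primitive_zero\<close> and parameters of size at most
  \<open>2 * \<bar>g\<bar> * \<eta>\<close>.\<close>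
lemma two_zeros_in_residue_class:
  assumes "disc \<noteq> 0"
    and H: "\<bar>c11\<bar> \<le> H" "\<bar>c22\<bar> \<le> H" "\<bar>c33\<bar> \<le> H" "\<bar>c12\<bar> \<le> H" "\<bar>c13\<bar> \<le> H" "\<bar>c23\<bar> \<le> H"
    and "\<eta> > 0" and x: "x \<noteq> 0" "qf x = 0"
  defines "B \<equiv> 5184 * H^2 * \<bar>disc\<bar> * \<eta>^3"
  obtains a b where "qf a = 0" "qf b = 0" "polar a b \<noteq> 0"
    "\<And>i. [a$i = x$i] (mod \<eta>)" "\<And>i. [b$i = x$i] (mod \<eta>)"
    "\<And>i. \<bar>a$i\<bar> \<le> B" "\<And>i. \<bar>b$i\<bar> \<le> B"
proof -
  obtain k y where y: "k \<noteq> 0" "primitive y" "x = k *s y"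
    using primitive_part[OF x(1)] .
  have "k^2 * qf y = 0"
    using x(2) unfolding y(3) qf_scale .
  then have qy: "qf y = 0" using y(1) by simp
  obtain e where e: "primitive e" "qf e = 0" "\<And>i. \<bar>e$i\<bar> \<le> 72 * H"
    using small_primitive_zero[OF assms(1) H y(2) qy] by blast
  obtain s0 g where g: "chord e s0 = g *s y" "g dvd disc"
    using zero_from_chord[OF assms(1) e(1,2) y(2) qy] .
  have "g \<noteq> 0" using g(2) assms(1) by auto
  have g_le: "\<bar>g\<bar> \<le> \<bar>disc\<bar>"
    using g(2) assms(1) by (simp add: dvd_imp_le_int)
  define m where "m = \<bar>g\<bar> * \<eta>"
  have "m > 0" using \<open>g \<noteq> 0\<close> \<open>\<eta> > 0\<close> by (simp add: m_def)
  have "e \<noteq> 0"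
    using e(1) by (auto simp: primitive_def idot_def)
  define s where "s = s0 + m *s (\<chi> i. - (s0$i div m))"
  have s_nth: "s$i = s0$i mod m" for i
    by (simp add: s_def minus_mult_div_eq_mod)
  have s_bd: "0 \<le> s$i" "s$i < m" for i
    using \<open>m > 0\<close> by (simp_all add: s_nth)
  \<comment> \<open>The representative is taken in \<open>{1..\<eta>}\<close>, not \<open>{0..<\<eta>}\<close>, so that multiplication by it does
    not kill the zero when \<open>\<eta>\<close> divides \<open>k\<close>.\<close>
  define k' where "k' = (k - 1) mod \<eta> + 1"
  have k': "1 \<le> k'" "k' \<le> \<eta>"
    unfolding k'_def using \<open>\<eta> > 0\<close> pos_mod_bound[of \<eta> "k - 1"] pos_mod_sign[of \<eta> "k - 1"]
    by linarith+
  have k'_cong: "[k' = k] (mod \<eta>)"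
    by (simp add: k'_def cong_def mod_add_left_eq)
  have lift: "\<exists>r. chord e (s + m *s z) = g *s r \<and> (\<forall>i. [k' * r$i = x$i] (mod \<eta>))
      \<and> (\<forall>i. \<bar>k' * r$i\<bar> \<le> B) \<and> qf (k' *s r) = 0"
    if z: "\<And>i. 0 \<le> z$i \<and> z$i \<le> 1" for z
  proof -
    have "s + m *s z = s0 + m *s ((\<chi> i. - (s0$i div m)) + z)"
      by (simp add: s_def vec_eq_iff algebra_simps)
    then obtain z' where z': "chord e (s + m *s z) = chord e s0 + m *s z'"
      using chord_shift by metis
    \<comment> \<open>The sign turns the modulus \<open>\<bar>g\<bar> * \<eta>\<close> into a multiple of \<open>g\<close>.\<close>
    define r where "r = y + (sgn g * \<eta>) *s z'"
    have gsgn: "\<bar>g\<bar> = g * sgn g" by (simp add: abs_sgn)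
    have r: "chord e (s + m *s z) = g *s r"
      unfolding z' g(1) by (simp add: r_def m_def gsgn vec_eq_iff algebra_simps)
    have "[k' * r$i = x$i] (mod \<eta>)" for i
    proof -
      have "[k' * r$i = k' * y$i] (mod \<eta>)"
        by (simp add: r_def cong_iff_dvd_diff algebra_simps)
      also have "[k' * y$i = k * y$i] (mod \<eta>)"
        using k'_cong by (rule cong_scalar_right)
      finally show ?thesis by (simp add: y(3))
    qed
    moreover have "\<bar>k' * r$i\<bar> \<le> B" for i
    proof -
      have "\<bar>(s + m *s z)$i\<bar> \<le> 2 * m" for i
      proof -
        have "0 \<le> m * z$i" "m * z$i \<le> m * 1"
          using z[of i] \<open>m > 0\<close> by (simp, intro mult_left_mono) auto
        then show ?thesis
          using s_bd[of i] by (simp only: vector_add_component vector_smult_component)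
      qed
      then have "\<bar>chord e (s + m *s z) $ i\<bar> \<le> 18 * H * (72 * H) * (2 * m)^2"
        by (rule chord_bound[OF H e(3)])
      then have "\<bar>g\<bar> * \<bar>r$i\<bar> \<le> \<bar>g\<bar> * (5184 * H^2 * \<bar>g\<bar> * \<eta>^2)"
        unfolding r by (simp add: abs_mult m_def power2_eq_square algebra_simps)
      then have ri: "\<bar>r$i\<bar> \<le> 5184 * H^2 * \<bar>g\<bar> * \<eta>^2"
        using \<open>g \<noteq> 0\<close> by (simp add: mult_le_cancel_left)
      have "\<bar>k' * r$i\<bar> \<le> \<eta> * (5184 * H^2 * \<bar>g\<bar> * \<eta>^2)"
        unfolding abs_mult using k' \<open>\<eta> > 0\<close> ri by (intro mult_mono) auto
      also have "\<dots> = 5184 * H^2 * \<eta>^3 * \<bar>g\<bar>"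
        by (simp add: power2_eq_square power3_eq_cube)
      also have "\<dots> \<le> 5184 * H^2 * \<eta>^3 * \<bar>disc\<bar>"
        using g_le \<open>\<eta> > 0\<close> by (intro mult_left_mono) auto
      finally show ?thesis by (simp add: B_def ac_simps)
    qed
    moreover have "g^2 * qf r = 0"
      using qf_chord[OF e(2), of "s + m *s z"] unfolding r qf_scale .
    then have "qf (k' *s r) = 0"
      using \<open>g \<noteq> 0\<close> by (simp add: qf_scale)
    ultimately show ?thesis using r by blast
  qed
  obtain z1 z2 where z1: "\<And>i. 0 \<le> z1$i \<and> z1$i \<le> 1" and z2: "\<And>i. 0 \<le> z2$i \<and> z2$i \<le> 1"
    and ind: "(s + m *s z2) \<bullet>\<^sub>Z (e \<times>\<^sub>Z (s + m *s z1)) \<noteq> 0"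
    using independent_shift[OF \<open>e \<noteq> 0\<close>, of m s] \<open>m > 0\<close> by blast
  obtain r1 where r1: "chord e (s + m *s z1) = g *s r1" "\<And>i. [k' * r1$i = x$i] (mod \<eta>)"
      "\<And>i. \<bar>k' * r1$i\<bar> \<le> B" "qf (k' *s r1) = 0"
    using lift[OF z1] by blast
  obtain r2 where r2: "chord e (s + m *s z2) = g *s r2" "\<And>i. [k' * r2$i = x$i] (mod \<eta>)"
      "\<And>i. \<bar>k' * r2$i\<bar> \<le> B" "qf (k' *s r2) = 0"
    using lift[OF z2] by blast
  have "polar (chord e (s + m *s z1)) (chord e (s + m *s z2)) \<noteq> 0"
    using ind assms(1) by (simp add: polar_chord[OF e(2)])
  then have "polar (k' *s r1) (k' *s r2) \<noteq> 0"
    using k'(1) by (simp add: r1(1) r2(1) polar_scale_left polar_scale_right)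
  with r1 r2 that[of "k' *s r1" "k' *s r2"] show thesis by simp
qed

end


section \<open>Transfer to real forms\<close>

text \<open>A form that vanishes at \<open>b\<close> vanishes on the whole line of \<open>b\<close>; if \<open>a\<close> were on this line, so
  would be \<open>a + b\<close>. For zeros \<open>a\<close>, \<open>b\<close> the value of the form at \<open>a + b\<close> is the value of the
  polar form at \<open>a\<close>, \<open>b\<close>.\<close>
lemma independent_zeros:
  fixes Q :: "real^'n \<Rightarrow> real"
  assumes Q: "quadratic_form Q" and "Q a = 0" "Q b = 0" "Q (a + b) \<noteq> 0"
  shows "a \<noteq> b \<and> independent {a, b}"
proof -
  have scale: "Q (t *\<^sub>R v) = t^2 * Q v" for t v
    by (simp add: qf_eq_matrix[OF Q] matrix_vector_mult_scaleR power2_eq_square)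
  have "a \<noteq> t *\<^sub>R b" for t
  proof
    assume "a = t *\<^sub>R b"
    then have "a + b = (t + 1) *\<^sub>R b" by (simp add: algebra_simps)
    with assms(3,4) show False by (simp add: scale)
  qed
  moreover from this[of 1] have "a \<noteq> b" by simp
  moreover have "b \<noteq> 0"
    using assms(2,4) by auto
  ultimately show ?thesis
    by (auto simp: independent_insert span_singleton)
qed

theorem theorem2p3:
  shows "\<exists>C>0. \<forall>(Q :: real^3 \<Rightarrow> real) (\<xi> :: int^3) (\<eta> :: nat).
    quadratic_form Q \<longrightarrow> integral_coeffs Q \<longrightarrow> nondegenerate Q \<longrightarrow> \<eta> > 0 \<longrightarrow>
    (\<exists>x. x \<noteq> 0 \<and> congruent_zero Q \<xi> \<eta> x) \<longrightarrow>
    (\<exists>a b. real_vec a \<noteq> real_vec b \<and> independent {real_vec a, real_vec b} \<and>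
      congruent_zero Q \<xi> \<eta> a \<and> congruent_zero Q \<xi> \<eta> b \<and>
      norm (real_vec a) * norm (real_vec b)
        \<le> C * qf_height Q ^ 4 * real \<eta> ^ 6 * \<bar>qf_det Q\<bar> ^ 4)"
proof (intro exI[of _ "9 * 5184^2 * 256 :: real"] conjI allI impI)
  fix Q :: "real^3 \<Rightarrow> real" and \<xi> :: "int^3" and \<eta> :: nat
  assume Q: "quadratic_form Q" and int: "integral_coeffs Q" and nd: "nondegenerate Q"
    and \<eta>: "\<eta> > 0" and "\<exists>x. x \<noteq> 0 \<and> congruent_zero Q \<xi> \<eta> x"
  then obtain x where x: "x \<noteq> 0" "congruent_zero Q \<xi> \<eta> x" by blast
  define c where "c i j = \<lfloor>qf_coeff Q i j\<rfloor>" for i j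
  have c: "qf_coeff Q i j = real_of_int (c i j)" for i j
    using int by (simp add: integral_coeffs_def c_def)
  interpret F: ternary_form "c 1 1" "c 2 2" "c 3 3" "c 1 2" "c 1 3" "c 2 3" .
  have Q_int: "Q (real_vec v) = real_of_int (F.qf v)" for v
    by (simp add: qf_expand_3[OF Q] c F.qf_def real_vec_def)
  have det: "4 * qf_det Q = real_of_int F.disc"
  proof -
    have sym: "qf_matrix Q $ j $ i = qf_matrix Q $ i $ j" for i j
      using arg_cong[OF transpose_qf_matrix[OF Q], of "\<lambda>A. A $ i $ j"]
      by (simp add: transpose_def)
    have entry: "qf_matrix Q $ i $ j = real_of_int (c i j) / (if i = j then 1 else 2)" for i j
      unfolding c[symmetric] by (simp add: qf_coeff_def)
    have entries: "qf_matrix Q $ 1 $ 1 = real_of_int (c 1 1)" "qf_matrix Q $ 2 $ 2 = real_of_int (c 2 2)"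
      "qf_matrix Q $ 3 $ 3 = real_of_int (c 3 3)" "qf_matrix Q $ 1 $ 2 = real_of_int (c 1 2) / 2"
      "qf_matrix Q $ 1 $ 3 = real_of_int (c 1 3) / 2" "qf_matrix Q $ 2 $ 3 = real_of_int (c 2 3) / 2"
      "qf_matrix Q $ 2 $ 1 = real_of_int (c 1 2) / 2"
      "qf_matrix Q $ 3 $ 1 = real_of_int (c 1 3) / 2"
      "qf_matrix Q $ 3 $ 2 = real_of_int (c 2 3) / 2"
      unfolding sym[of 2 1] sym[of 3 1] sym[of 3 2] by (simp_all only: entry) simp_all
    show ?thesis
      unfolding qf_det_def det_3 entries F.disc_def by (simp add: power2_eq_square field_simps)
  qed
  define H where "H = \<lfloor>qf_height Q\<rfloor>"
  have H_le: "real_of_int H \<le> qf_height Q"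
    by (simp add: H_def)
  have H: "\<bar>c i j\<bar> \<le> H" for i j
  proof -
    have "{\<bar>qf_coeff Q i j\<bar> |i j. True} = range (\<lambda>(i, j). \<bar>qf_coeff Q i j\<bar>)"
      by auto
    then have "\<bar>qf_coeff Q i j\<bar> \<le> qf_height Q"
      unfolding qf_height_def by (intro Max_ge) auto
    then show ?thesis
      by (simp add: H_def c le_floor_iff)
  qed
  have disc: "F.disc \<noteq> 0"
    using nd det by (auto simp: nondegenerate_def)
  have H0: "0 \<le> H"
    using F.height_pos[OF disc H H H H H H] by simp
  have qx: "F.qf x = 0"
    using x(2) by (simp add: congruent_zero_def Q_int)
  define B where "B = 5184 * H^2 * \<bar>F.disc\<bar> * int \<eta>^3"
  obtain a b where ab: "F.qf a = 0" "F.qf b = 0" "F.polar a b \<noteq> 0"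
    and a: "\<And>i. [a$i = x$i] (mod int \<eta>)" "\<And>i. \<bar>a$i\<bar> \<le> B"
    and b: "\<And>i. [b$i = x$i] (mod int \<eta>)" "\<And>i. \<bar>b$i\<bar> \<le> B"
    using F.two_zeros_in_residue_class[OF disc H H H H H H _ x(1) qx, of "int \<eta>"] \<eta>
    unfolding B_def by (metis of_nat_0_less_iff)
  have "real_vec (a + b) = real_vec a + real_vec b"
    by (simp add: real_vec_def vec_eq_iff)
  then have "Q (real_vec a + real_vec b) = real_of_int (F.qf (a + b))"
    by (metis Q_int)
  then have ind: "real_vec a \<noteq> real_vec b \<and> independent {real_vec a, real_vec b}"
    using ab by (intro independent_zeros[OF Q]) (auto simp: Q_int F.qf_add)
  have zero: "congruent_zero Q \<xi> \<eta> v"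
    if "F.qf v = 0" "\<And>i. [v$i = x$i] (mod int \<eta>)" for v
    using that x(2) unfolding congruent_zero_def Q_int by (auto intro: cong_trans)
  have norm: "norm (real_vec v) \<le> 3 * real_of_int B" if "\<And>i. \<bar>v$i\<bar> \<le> B" for v :: "int^3"
  proof -
    have "norm (real_vec v) \<le> (\<Sum>i\<in>UNIV. \<bar>real_vec v $ i\<bar>)"
      by (rule norm_le_l1_cart)
    also have "\<dots> \<le> (\<Sum>i\<in>(UNIV::3 set). real_of_int B)"
      by (intro sum_mono) (use that in \<open>simp add: real_vec_def flip: of_int_abs\<close>)
    finally show ?thesis by simp
  qed
  have "norm (real_vec a) * norm (real_vec b) \<le> (3 * real_of_int B) * (3 * real_of_int B)"
    using norm[OF a(2)] norm[OF b(2)]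
    by (intro mult_mono order.trans[OF norm_ge_zero norm[OF a(2)]]) auto
  also have "\<dots> = 9 * 5184^2 * real_of_int H^4 * real \<eta>^6 * (real_of_int F.disc)^2"
    by (simp add: B_def power2_eq_square power_numeral_reduce)
  \<comment> \<open>The step from \<open>D\<^sup>2\<close> to \<open>D^4\<close> uses that \<open>D = 4 det Q\<close> is a nonzero integer; \<open>det Q\<close> itself may be
    smaller than one in absolute value.\<close>
  also have "\<dots> \<le> 9 * 5184^2 * qf_height Q^4 * real \<eta>^6 * (real_of_int F.disc)^4"
  proof (intro mult_mono power_mono order.refl H_le)
    have "1 \<le> \<bar>F.disc\<bar>" using disc by simp
    then have "\<bar>F.disc\<bar>^2 \<le> \<bar>F.disc\<bar>^4" by (intro power_increasing) auto
    then have "F.disc^2 \<le> F.disc^4" by simp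
    then show "(real_of_int F.disc)^2 \<le> (real_of_int F.disc)^4"
      by (metis of_int_le_iff of_int_power)
  qed (use H0 in \<open>auto intro!: mult_nonneg_nonneg\<close>)
  also have "\<dots> = 9 * 5184^2 * 256 * qf_height Q^4 * real \<eta>^6 * \<bar>qf_det Q\<bar>^4"
    by (simp flip: det add: power_mult_distrib)
  finally show "\<exists>a b. real_vec a \<noteq> real_vec b \<and> independent {real_vec a, real_vec b} \<and>
      congruent_zero Q \<xi> \<eta> a \<and> congruent_zero Q \<xi> \<eta> b \<and>
      norm (real_vec a) * norm (real_vec b)
        \<le> 9 * 5184^2 * 256 * qf_height Q ^ 4 * real \<eta> ^ 6 * \<bar>qf_det Q\<bar> ^ 4"
    using ind zero[OF ab(1) a(1)] zero[OF ab(2) b(1)] by blast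
qed simp

end
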